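(* $\mathcal{I}_{\mathrm{ferro}}\subseteq\langle\mathcal{M}\rangle_\omega\cap\mathcal{H}_{\mathrm{ferro}}$.
   Context: $\mathcal{B}_k$ is the set of functions $\{0,1\}^k\to\mathbb{R}_{\ge0}$, $\mathcal{B}=\bigcup_k\mathcal{B}_k$. $\mathrm{EQ}$ is the binary equality indicator. $\langle\mathcal{F}\rangle$ is the closure of $\mathcal{F}\cup\{\mathrm{EQ}\}$ under introducing fictitious arguments, permuting arguments, pointwise product of equal-arity functions, and summing out an argument over $\{0,1\}$; a $k$-ary $f$ is a limit of $\mathcal{F}$ if there is a finite $S\subseteq\mathcal{F}$ such that for all $\epsilon>0$ some $k$-ary $f_\epsilon\in\langle S\rangle$ has $\max_\mathbf{x}|f-f_\epsilon|<\epsilon$; $\langle\mathcal{F}\rangle_\omega$ is the closure of $\mathcal{F}\cup\{\mathrm{EQ}\}$ under the four operations and limits. Fourier transform: $\widehat f(\mathbf{x})=2^{-k}\sum_{\mathbf{w}}(-1)^{|\mathbf{w}\wedge\mathbf{x}|}f(\mathbf{w})$ ($|\cdot|$ Hamming weight). An arity-$k$ match-circuit is an undirected graph with external degree-1 vertices $u_1,\dots,u_k$ whose incident edges $y_1,\dots,y_k$ (terminals) have weight 1, internal vertices $v_1,\dots,v_n$ ($n\ge k$), and weights $w_e>0$ on the other edges; it implements $f(y_1,\dots,y_k)=\sum_H\prod_{e\in H}w_e$ over edge sets $H$ containing exactly the terminals set to 1 in which each internal vertex lies in exactly one edge. $\mathcal{M}=\{f\in\mathcal{B}:\widehat f$ is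 implemented by a match-circuit$\}$. $\mathrm{Ising}_k^\lambda\in\mathcal{B}_k$ ($\lambda\ge0$) equals 1 on the all-0 and all-1 tuples and $\lambda$ elsewhere. $\mathcal{I}_{\mathrm{ferro}}=\langle\{\mathrm{Ising}_2^\lambda:0\le\lambda\le1\}\cup\mathcal{B}_0\rangle_\omega$, $\mathcal{H}_{\mathrm{ferro}}=\langle\{\mathrm{Ising}_k^\lambda:k\ge2,0\le\lambda\le1\}\cup\mathcal{B}_0\rangle_\omega$. *)

theory Defs
  imports Complex_Main "HOL-Library.FuncSet" "HOL-Combinatorics.Permutations"
begin

(* A function of arity k is the pair of k and a function that is undefined outside {0,1}^k
   (Boolean lists of length k, True = 1). The extensional representation makes equality of
   pairs coincide with equality of arity and values. *)
type_synonym bfun = "nat \<times> (bool list \<Rightarrow> real)"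

definition cube :: "nat \<Rightarrow> bool list set" where
  "cube k = {x. length x = k}"

definition B_arity :: "nat \<Rightarrow> bfun set" where
  "B_arity k = {k} \<times> (cube k \<rightarrow>\<^sub>E {0..})"

definition B_all :: "bfun set" where
  "B_all = (\<Union>k. B_arity k)"

definition EQ :: bfun where
  "EQ = (2, \<lambda>x\<in>cube 2. if x ! 0 = x ! 1 then 1 else 0)"

(* The four operations. A fictitious argument is added, and an argument is summed out, in the
   last position; other positions are reached by permuting arguments. *)

definition add_fictitious :: "bfun \<Rightarrow> bfun" where
  "add_fictitious = (\<lambda>(k, f). (Suc k, \<lambda>x\<in>cube (Suc k). f (butlast x)))"

definition permute_args :: "(nat \<Rightarrow> nat) \<Rightarrow> bfun \<Rightarrow> bfun" where
  "permute_args \<pi> = (\<lambda>(k, f). (k, \<lambda>x\<in>cube k. f (map (\<lambda>i. x ! \<pi> i) [0..<k])))"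

definition product :: "nat \<Rightarrow> (bool list \<Rightarrow> real) \<Rightarrow> (bool list \<Rightarrow> real) \<Rightarrow> bfun" where
  "product k f g = (k, \<lambda>x\<in>cube k. f x * g x)"

definition sum_out :: "nat \<Rightarrow> (bool list \<Rightarrow> real) \<Rightarrow> bfun" where
  "sum_out k f = (k, \<lambda>x\<in>cube k. \<Sum>b\<in>UNIV. f (x @ [b]))"

inductive_set clone :: "bfun set \<Rightarrow> bfun set" for F :: "bfun set" where
  base: "a \<in> F \<Longrightarrow> a \<in> clone F"
| eq: "EQ \<in> clone F"
| fictitious: "a \<in> clone F \<Longrightarrow> add_fictitious a \<in> clone F"
| permute: "(k, f) \<in> clone F \<Longrightarrow> \<pi> permutes {..<k} \<Longrightarrow> permute_args \<pi> (k, f) \<in> clone F"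
| prod: "(k, f) \<in> clone F \<Longrightarrow> (k, g) \<in> clone F \<Longrightarrow> product k f g \<in> clone F"
| sum: "(Suc k, f) \<in> clone F \<Longrightarrow> sum_out k f \<in> clone F"

definition limits :: "bfun set \<Rightarrow> bfun set" where
  "limits F = {(k, f). (k, f) \<in> B_arity k \<and>
     (\<exists>S. S \<subseteq> F \<and> finite S \<and>
       (\<forall>\<epsilon>>0. \<exists>g. (k, g) \<in> clone S \<and> (MAX x\<in>cube k. \<bar>f x - g x\<bar>) < \<epsilon>))}"

(* Lets the inductive definition below accept limits of the set being defined. *)
lemma limits_mono:
  "(\<And>x. P x \<longrightarrow> Q x) \<Longrightarrow> a \<in> limits {x. P x} \<longrightarrow> a \<in> limits {x. Q x}"
  unfolding limits_def by blast

inductive_set omega_clone :: "bfun set \<Rightarrow> bfun set" for F :: "bfun set" where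
  base: "a \<in> F \<Longrightarrow> a \<in> omega_clone F"
| eq: "EQ \<in> omega_clone F"
| fictitious: "a \<in> omega_clone F \<Longrightarrow> add_fictitious a \<in> omega_clone F"
| permute: "(k, f) \<in> omega_clone F \<Longrightarrow> \<pi> permutes {..<k} \<Longrightarrow>
    permute_args \<pi> (k, f) \<in> omega_clone F"
| prod: "(k, f) \<in> omega_clone F \<Longrightarrow> (k, g) \<in> omega_clone F \<Longrightarrow> product k f g \<in> omega_clone F"
| sum: "(Suc k, f) \<in> omega_clone F \<Longrightarrow> sum_out k f \<in> omega_clone F"
| limit: "a \<in> limits (omega_clone F) \<Longrightarrow> a \<in> omega_clone F"
  monos limits_mono

definition hamming_weight :: "bool list \<Rightarrow> nat" where
  "hamming_weight x = count_list x True"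

definition fourier :: "nat \<Rightarrow> (bool list \<Rightarrow> real) \<Rightarrow> bool list \<Rightarrow> real" where
  "fourier k f x = (1 / 2 ^ k) * (\<Sum>w\<in>cube k. (- 1) ^ hamming_weight (map2 (\<and>) w x) * f w)"

(* Vertices u_1, ..., u_k and v_1, ..., v_n are External i (i < k) and Internal j (j < n).
   Edges are two-element vertex sets, so graphs are simple and loopless. *)
datatype cvertex = External nat | Internal nat

record circuit =
  num_internal :: nat
  edges :: "cvertex set set"
  weight :: "cvertex set \<Rightarrow> real"

definition vertices :: "nat \<Rightarrow> circuit \<Rightarrow> cvertex set" where
  "vertices k G = External ` {..<k} \<union> Internal ` {..<num_internal G}"

definition degree_in :: "cvertex set set \<Rightarrow> cvertex \<Rightarrow> nat" where
  "degree_in H v = card {e \<in> H. v \<in> e}"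

(* The unique edge at u_i, provided u_i has degree 1. *)
definition terminal :: "circuit \<Rightarrow> nat \<Rightarrow> cvertex set" where
  "terminal G i = (THE e. e \<in> edges G \<and> External i \<in> e)"

(* Injectivity of terminal says that the k terminals are k different edges, i.e. no edge
   joins two external vertices. *)
definition match_circuit :: "nat \<Rightarrow> circuit \<Rightarrow> bool" where
  "match_circuit k G \<longleftrightarrow>
     k \<le> num_internal G \<and>
     (\<forall>e\<in>edges G. e \<subseteq> vertices k G \<and> card e = 2) \<and>
     (\<forall>i<k. degree_in (edges G) (External i) = 1) \<and>
     inj_on (terminal G) {..<k} \<and>
     (\<forall>i<k. weight G (terminal G i) = 1) \<and>
     (\<forall>e \<in> edges G - terminal G ` {..<k}. weight G e > 0)"

definition circuit_value :: "nat \<Rightarrow> circuit \<Rightarrow> bool list \<Rightarrow> real" where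
  "circuit_value k G y =
     (\<Sum>H | H \<subseteq> edges G \<and>
           (\<forall>i<k. terminal G i \<in> H \<longleftrightarrow> y ! i) \<and>
           (\<forall>j<num_internal G. degree_in H (Internal j) = 1).
        \<Prod>e\<in>H. weight G e)"

definition implements :: "nat \<Rightarrow> circuit \<Rightarrow> (bool list \<Rightarrow> real) \<Rightarrow> bool" where
  "implements k G f \<longleftrightarrow> match_circuit k G \<and> (\<forall>y\<in>cube k. f y = circuit_value k G y)"

definition M_match :: "bfun set" where
  "M_match = {(k, f) \<in> B_all. \<exists>G. implements k G (fourier k f)}"

definition Ising :: "nat \<Rightarrow> real \<Rightarrow> bfun" where
  "Ising k l =
     (k, \<lambda>x\<in>cube k. if x = replicate k False \<or> x = replicate k True then 1 else l)"

definition I_ferro :: "bfun set" where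
  "I_ferro = omega_clone ({Ising 2 l | l. 0 \<le> l \<and> l \<le> 1} \<union> B_arity 0)"

definition H_ferro :: "bfun set" where
  "H_ferro = omega_clone ({Ising k l | k l. 2 \<le> k \<and> 0 \<le> l \<and> l \<le> 1} \<union> B_arity 0)"

end

theory Submission
  imports Defs
begin

text \<open>
  It suffices that the generators of the ferromagnetic Ising clone lie in both clones. For
  \<open>\<lambda> < 1\<close> the Fourier transform of \<open>Ising 2 \<lambda>\<close> is
  \<open>(1 + \<lambda>)/2\<close> on 00, \<open>(1 - \<lambda>)/2\<close> on 11 and 0 elsewhere. Two terminals whose
  internal ends are joined by an edge of weight \<open>(1 + \<lambda>)/(1 - \<lambda>)\<close>, next to a
  disjoint edge of weight \<open>(1 - \<lambda>)/2\<close> that scales the whole function, implement it.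
  For \<open>\<lambda> = 1\<close> the weights degenerate, but \<open>Ising 2 1\<close> is the nullary function 1
  with two fictitious arguments.
\<close>

lemma limits_subset: "A \<subseteq> B \<Longrightarrow> limits A \<subseteq> limits B"
  unfolding limits_def by blast

text \<open>The larger clone is itself closed under all the generating rules, limits included, so
  checking the generators is enough.\<close>

lemma omega_clone_least:
  assumes "F \<subseteq> omega_clone G"
  shows "omega_clone F \<subseteq> omega_clone G"
proof
  fix a
  assume "a \<in> omega_clone F"
  then show "a \<in> omega_clone G"
  proof (induction rule: omega_clone.induct)
    case (base a)
    then show ?case using assms by blast
  next
    \<comment> \<open>Here \<open>a\<close> is a limit of those members of
      \<open>omega_clone F\<close> that already lie in \<open>omega_clone G\<close>; by monotonicity
      it is a limit of \<open>omega_clone G\<close> itself.\<close>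
    case (limit a)
    then show ?case
      using limits_subset[of "{x \<in> omega_clone F. x \<in> omega_clone G}" "omega_clone G"]
      by (blast intro: omega_clone.limit)
  qed (auto intro: omega_clone.intros)
qed

lemma cube_0: "cube 0 = {[]}"
  by (auto simp: cube_def)

lemma cube_2: "cube 2 = {[False, False], [False, True], [True, False], [True, True]}"
  by (auto simp: cube_def numeral_2_eq_2 length_Suc_conv)

text \<open>Allowing \<open>a = b\<close> lets one statement cover internal vertices with one
  incident edge as well as those with two.\<close>

lemma degree_in_1_iff:
  assumes "{e \<in> E. v \<in> e} = {a, b}" "H \<subseteq> E"
  shows "degree_in H v = 1 \<longleftrightarrow> (a = b \<and> a \<in> H) \<or> (a \<in> H) \<noteq> (b \<in> H)"
proof -
  have "{e \<in> H. v \<in> e} = H \<inter> {a, b}"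
    using assms by blast
  moreover have "card (H \<inter> {a, b}) = 1 \<longleftrightarrow> (a = b \<and> a \<in> H) \<or> (a \<in> H) \<noteq> (b \<in> H)"
    by (cases "a \<in> H"; cases "b \<in> H"; cases "a = b") auto
  ultimately show ?thesis
    by (simp add: degree_in_def)
qed

text \<open>The only perfect matching is the edge itself, so every positive constant occurs as a
  nullary value.\<close>

definition edge_circuit :: "real \<Rightarrow> circuit" where
  "edge_circuit c =
     \<lparr>num_internal = 2, edges = {{Internal 0, Internal 1}}, weight = \<lambda>_. c\<rparr>"

text \<open>Edge weights must be positive, so the constant 0 comes from an isolated internal vertex:
  it cannot be matched and the sum is empty.\<close>

definition vertex_circuit :: circuit where
  "vertex_circuit = \<lparr>num_internal = 1, edges = {}, weight = \<lambda>_. 1\<rparr>"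

lemma implements_edge_circuit:
  assumes "c > 0" "f [] = c"
  shows "implements 0 (edge_circuit c) f"
proof -
  let ?e = "{Internal 0, Internal 1}"
  have "(H \<subseteq> {?e} \<and> (\<forall>j<2. degree_in H (Internal j) = 1)) \<longleftrightarrow> H = {?e}" for H
  proof -
    have "degree_in H (Internal j) = 1 \<longleftrightarrow> ?e \<in> H" if "H \<subseteq> {?e}" "j < 2" for j
      using that by (subst degree_in_1_iff[of "{?e}" _ ?e ?e]) (auto simp: less_2_cases_iff)
    then show ?thesis by fastforce
  qed
  then have "circuit_value 0 (edge_circuit c) [] = c"
    by (simp add: circuit_value_def edge_circuit_def)
  then show ?thesis
    using assms
    by (auto simp: implements_def match_circuit_def edge_circuit_def vertices_def cube_0)
qed

lemma implements_vertex_circuit: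
  assumes "f [] = 0"
  shows "implements 0 vertex_circuit f"
proof -
  have "{H. H = {} \<and> degree_in H (Internal 0) = Suc 0} = {}"
    by (auto simp: degree_in_def)
  then have "circuit_value 0 vertex_circuit [] = 0"
    by (simp add: circuit_value_def vertex_circuit_def)
  then show ?thesis
    using assms by (auto simp: implements_def match_circuit_def vertex_circuit_def cube_0)
qed

text \<open>In arity 0 the Fourier transform is the identity, so only nonnegative constants have to
  be implemented.\<close>

lemma B_arity_0_subset_M_match: "B_arity 0 \<subseteq> M_match"
proof
  fix a
  assume a: "a \<in> B_arity 0"
  then obtain f where f: "a = (0, f)" "f [] \<ge> 0"
    by (auto simp: B_arity_def cube_0 PiE_iff)
  have "fourier 0 f [] = f []"
    by (simp add: fourier_def cube_0 hamming_weight_def)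
  then have "\<exists>G. implements 0 G (fourier 0 f)"
    using f(2) implements_edge_circuit[of "f []" "fourier 0 f"]
      implements_vertex_circuit[of "fourier 0 f"]
    by (cases "f [] = 0") auto
  then show "a \<in> M_match"
    using a f(1) by (auto simp: M_match_def B_all_def)
qed

definition ising_circuit :: "real \<Rightarrow> real \<Rightarrow> circuit" where
  "ising_circuit p q =
     \<lparr>num_internal = 4,
      edges = {{External 0, Internal 0}, {External 1, Internal 1},
               {Internal 0, Internal 1}, {Internal 2, Internal 3}},
      weight = \<lambda>e. if e = {Internal 0, Internal 1} then p
                   else if e = {Internal 2, Internal 3} then q else 1\<rparr>"

text \<open>The edge of weight \<open>q\<close> is forced. The edge of weight \<open>p\<close> is
  used exactly when a terminal is not, for either terminal, so the terminals agree and each agreeing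
  input admits exactly one matching.\<close>

lemma implements_ising_circuit:
  assumes "p > 0" "q > 0"
    and "f [False, False] = p * q" "f [True, True] = q"
    and "f [False, True] = 0" "f [True, False] = 0"
  shows "implements 2 (ising_circuit p q) f"
proof -
  define t0 t1 e g where
    "t0 = {External 0, Internal 0}" and "t1 = {External 1, Internal 1}" and
    "e = {Internal 0, Internal 1}" and "g = {Internal 2, Internal 3}"
  note defs = t0_def t1_def e_def g_def
  let ?E = "{t0, t1, e, g}"
  let ?G = "ising_circuit p q"
  have neq: "t0 \<noteq> t1" "t0 \<noteq> e" "t0 \<noteq> g" "t1 \<noteq> e" "t1 \<noteq> g" "e \<noteq> g"
    by (auto simp: defs doubleton_eq_iff)
  have G: "num_internal ?G = 4" "edges ?G = ?E"
    "weight ?G = (\<lambda>x. if x = e then p else if x = g then q else 1)"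
    by (auto simp: ising_circuit_def defs)
  have t: "terminal ?G 0 = t0" "terminal ?G 1 = t1"
    unfolding terminal_def G by (rule the_equality; auto simp: defs)+
  have deg: "(\<forall>j<4. degree_in H (Internal j) = 1) \<longleftrightarrow>
      (t0 \<in> H) \<noteq> (e \<in> H) \<and> (t1 \<in> H) \<noteq> (e \<in> H) \<and> g \<in> H" if "H \<subseteq> ?E" for H
  proof -
    \<comment> \<open>This evaluates the set of incident edges one edge at a time.\<close>
    have filter_insert: "{x \<in> insert a A. v \<in> x} =
        (if v \<in> a then insert a {x \<in> A. v \<in> x} else {x \<in> A. v \<in> x})"
      for v :: cvertex and a A
      by auto
    have "{x \<in> ?E. Internal 0 \<in> x} = {t0, e}" "{x \<in> ?E. Internal 1 \<in> x} = {t1, e}"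
      "{x \<in> ?E. Internal 2 \<in> x} = {g, g}" "{x \<in> ?E. Internal 3 \<in> x} = {g, g}"
      unfolding filter_insert by (simp_all add: defs)
    \<comment> \<open>The repeated \<open>{g, g}\<close> selects the case \<open>a = b\<close> for
      the two ends of the isolated edge.\<close>
    note inc = this[THEN degree_in_1_iff, OF that]
    have "degree_in H (Internal 0) = 1 \<longleftrightarrow> (t0 \<in> H) \<noteq> (e \<in> H)"
      "degree_in H (Internal 1) = 1 \<longleftrightarrow> (t1 \<in> H) \<noteq> (e \<in> H)"
      "degree_in H (Internal 2) = 1 \<longleftrightarrow> g \<in> H"
      "degree_in H (Internal 3) = 1 \<longleftrightarrow> g \<in> H"
      unfolding inc using neq by simp_all
    moreover have "(\<forall>j<4. P j) \<longleftrightarrow> P 0 \<and> P 1 \<and> P 2 \<and> P 3" for P :: "nat \<Rightarrow> bool"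
      by (auto simp: eval_nat_numeral less_Suc_eq)
    ultimately show ?thesis by simp
  qed
  have all2: "(\<forall>i<2. P i) \<longleftrightarrow> P 0 \<and> P 1" for P :: "nat \<Rightarrow> bool"
    by (auto simp: less_2_cases_iff)
  have val: "circuit_value 2 ?G y =
      (\<Sum>H | H \<subseteq> ?E \<and> (t0 \<in> H \<longleftrightarrow> y ! 0) \<and> (t1 \<in> H \<longleftrightarrow> y ! 1) \<and>
         (t0 \<in> H) \<noteq> (e \<in> H) \<and> (t1 \<in> H) \<noteq> (e \<in> H) \<and> g \<in> H.
        \<Prod>x\<in>H. weight ?G x)" for y
    unfolding circuit_value_def
    by (rule sum.cong) (use deg in \<open>auto simp: G(1,2) t[unfolded One_nat_def] all2\<close>)
  have "H \<subseteq> ?E \<and> t0 \<notin> H \<and> t1 \<notin> H \<and> e \<in> H \<and> g \<in> H \<longleftrightarrow> H = {e, g}" for H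
  proof
    assume "H \<subseteq> ?E \<and> t0 \<notin> H \<and> t1 \<notin> H \<and> e \<in> H \<and> g \<in> H"
    then show "H = {e, g}" by blast
  next
    assume "H = {e, g}"
    then show "H \<subseteq> ?E \<and> t0 \<notin> H \<and> t1 \<notin> H \<and> e \<in> H \<and> g \<in> H" using neq by simp
  qed
  then have sets_00: "{H. H \<subseteq> ?E \<and> t0 \<notin> H \<and> t1 \<notin> H \<and> e \<in> H \<and> g \<in> H} = {{e, g}}"
    by (simp only: singleton_conv)
  have "H \<subseteq> ?E \<and> t0 \<in> H \<and> t1 \<in> H \<and> e \<notin> H \<and> g \<in> H \<longleftrightarrow> H = {t0, t1, g}" for H
  proof
    assume "H \<subseteq> ?E \<and> t0 \<in> H \<and> t1 \<in> H \<and> e \<notin> H \<and> g \<in> H"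
    then show "H = {t0, t1, g}" by blast
  next
    assume "H = {t0, t1, g}"
    then show "H \<subseteq> ?E \<and> t0 \<in> H \<and> t1 \<in> H \<and> e \<notin> H \<and> g \<in> H" using neq by simp
  qed
  then have sets_11: "{H. H \<subseteq> ?E \<and> t0 \<in> H \<and> t1 \<in> H \<and> e \<notin> H \<and> g \<in> H} = {{t0, t1, g}}"
    by (simp only: singleton_conv)
  have v00: "circuit_value 2 ?G [False, False] = (\<Sum>H\<in>{{e, g}}. \<Prod>x\<in>H. weight ?G x)"
    unfolding val sets_00[symmetric] by (rule sum.cong) auto
  have v11: "circuit_value 2 ?G [True, True] = (\<Sum>H\<in>{{t0, t1, g}}. \<Prod>x\<in>H. weight ?G x)"
    unfolding val sets_11[symmetric] by (rule sum.cong) auto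
  have v01: "circuit_value 2 ?G [False, True] = 0" "circuit_value 2 ?G [True, False] = 0"
    unfolding val by (rule sum.neutral, force)+
  have "match_circuit 2 ?G"
  proof -
    have "{x \<in> ?E. External 0 \<in> x} = {t0}" "{x \<in> ?E. External 1 \<in> x} = {t1}"
      by (auto simp: defs)
    then have "\<forall>i<2. degree_in (edges ?G) (External i) = 1"
      unfolding all2 degree_in_def G by simp
    moreover have "\<forall>x\<in>edges ?G. x \<subseteq> vertices 2 ?G \<and> card x = 2"
      unfolding G vertices_def by (auto simp: defs)
    moreover have "inj_on (terminal ?G) {..<2}"
      using t neq by (auto simp: inj_on_def less_2_cases_iff)
    moreover have "\<forall>i<2. weight ?G (terminal ?G i) = 1"
      unfolding all2 t using neq by (simp add: G)
    moreover have "\<forall>x\<in>edges ?G - terminal ?G ` {..<2}. weight ?G x > 0"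
      using assms(1,2) by (auto simp: G)
    ultimately show ?thesis
      unfolding match_circuit_def by (simp add: G(1))
  qed
  then show ?thesis
    using assms(3-6) neq v00 v11 v01 by (simp add: implements_def cube_2 G(3))
qed

lemma Ising_2_in_M_match:
  assumes "0 \<le> l" "l < 1"
  shows "Ising 2 l \<in> M_match"
proof -
  define f where "f = snd (Ising 2 l)"
  have I: "Ising 2 l = (2, f)"
    by (simp add: f_def Ising_def)
  have f: "f [False, False] = 1" "f [True, True] = 1" "f [False, True] = l" "f [True, False] = l"
    by (simp_all add: f_def Ising_def cube_def numeral_2_eq_2)
  \<comment> \<open>The value \<open>(1 + l) / 2\<close> is written as the product of the two edge
    weights, matching \<open>p * q\<close>; \<open>l < 1\<close> makes both positive.\<close>
  have "fourier 2 f [False, False] = (1 + l) / (1 - l) * ((1 - l) / 2)"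
    "fourier 2 f [True, True] = (1 - l) / 2"
    "fourier 2 f [False, True] = 0" "fourier 2 f [True, False] = 0"
    using assms by (simp_all add: fourier_def cube_2 f hamming_weight_def field_simps)
  then have "implements 2 (ising_circuit ((1 + l) / (1 - l)) ((1 - l) / 2)) (fourier 2 f)"
    using assms by (intro implements_ising_circuit) auto
  moreover have "(2, f) \<in> B_arity 2"
    using assms by (auto simp: f_def Ising_def B_arity_def)
  ultimately show ?thesis
    unfolding I M_match_def B_all_def by blast
qed

lemma Ising_2_1_eq: "Ising 2 1 = add_fictitious (add_fictitious (0, \<lambda>x\<in>cube 0. 1))"
  by (auto simp: Ising_def add_fictitious_def cube_2 cube_0 cube_def numeral_2_eq_2
      fun_eq_iff length_Suc_conv)

theorem theorem8p2: "I_ferro \<subseteq> omega_clone M_match \<inter> H_ferro"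
proof -
  have B0: "B_arity 0 \<subseteq> omega_clone M_match"
    using B_arity_0_subset_M_match by (auto intro: omega_clone.base)
  have "(0, \<lambda>x\<in>cube 0. 1) \<in> B_arity 0"
    by (auto simp: B_arity_def)
  then have "Ising 2 1 \<in> omega_clone M_match"
    unfolding Ising_2_1_eq using B0 by (blast intro: omega_clone.fictitious)
  then have "Ising 2 l \<in> omega_clone M_match" if "0 \<le> l" "l \<le> 1" for l
    using that Ising_2_in_M_match[of l] by (cases "l = 1") (auto intro: omega_clone.base)
  then have "I_ferro \<subseteq> omega_clone M_match"
    unfolding I_ferro_def using B0 by (intro omega_clone_least) auto
  \<comment> \<open>The binary generators are the case \<open>k = 2\<close> of the generators of
    \<open>H_ferro\<close>.\<close>
  moreover have "I_ferro \<subseteq> H_ferro"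
    unfolding I_ferro_def H_ferro_def
    by (rule omega_clone_least) (auto intro!: omega_clone.base)
  ultimately show ?thesis by blast
qed

end
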